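(* Let $\ell\ge0$ be an integer, let ${\bf y}(t)=\varphi_\ell(-tA){\bf v}$ and ${\bf y}_{\ell,k}(t)=V_k\varphi_\ell(-tH_k)\beta{\bf e}_1$, and let $\Gamma$ be a closed contour enclosing the spectra of $-tA$ and $-tH_k$ such that $\varphi_\ell$ is analytic on and inside $\Gamma$. Denote by ${\bf e}_{\ell,k}(t)={\bf y}(t)-{\bf y}_{\ell,k}(t)$ the error and by ${\bf r}_{\ell,k}(t)$ the residual of ${\bf y}_{\ell,k}(t)$. Assume that ${\bf e}_{k}^{\mathrm{H}}\varphi_{\ell}(-tH_{k})\beta{\bf e}_{1}\neq 0$, and denote $$ f_{H_{k}}(z)=t\varphi_{\ell}(z)\cdot\frac{{\bf e}_{k}^{\mathrm{H}}(zI+tH_{k})^{-1}\beta{\bf e}_{1}}{{\bf e}_{k}^{\mathrm{H}}\varphi_{\ell}(-tH_{k})\beta{\bf e}_{1}}. $$ Then $$ {\bf e}_{\ell,k}(t)=\frac{1}{2\pi{\bf i}}\int_\Gamma f_{H_{k}}(z)(zI+tA)^{-1}{\bf r}_{\ell,k}(t)\,dz $$ and $$ \|{\bf e}_{\ell,k}(t)\|_2\leq\Big\|\frac{1}{2\pi{\bf i}}\int_\Gamma f_{H_{k}}(z)(zI+tA)^{-1}dz\Big\|_2\cdot\|{\bf r}_{\ell,k}(t)\|_2. $$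
   Context: The $\varphi$-functions are $\varphi_0(z)=e^z$ and $\varphi_\ell(z)=\frac{1}{(\ell-1)!}\int_0^1 e^{(1-\theta)z}\theta^{\ell-1}d\theta$ for $\ell\ge1$, $z\in\mathbb C$ (extended to square matrices as matrix functions). $A$ is an $n\times n$ matrix, $t>0$, the spectrum of $-tA$ lies in the (closed) left half plane, and ${\bf v}$ is a nonzero vector with $\beta=\|{\bf v}\|_2$. The $k$-step Arnoldi process started with ${\bf v}_1={\bf v}/\beta$ is assumed to produce $V_{k+1}=[{\bf v}_1,\dots,{\bf v}_{k+1}]=[V_k,{\bf v}_{k+1}]$ with orthonormal columns (spanning the Krylov subspace $\mathrm{span}\{{\bf v}_1,A{\bf v}_1,\dots,A^k{\bf v}_1\}$), a $k\times k$ upper Hessenberg matrix $H_k$ and a real scalar $h_{k+1,k}$ with $$AV_k=V_kH_k+h_{k+1,k}{\bf v}_{k+1}{\bf e}_k^{\mathrm{H}}.$$ Here ${\bf e}_j$ (single index) is the $j$-th column of the $k\times k$ identity matrix, $(\cdot)^{\mathrm{H}}$ is the conjugate transpose, ${\bf i}^2=-1$, and $'$ denotes $d/dt$. Contours are positively oriented. The residual is defined, for $\ell\ge1$, by $${\bf r}_{\ell,k}(t)=-A{\bf y}_{\ell,k}(t)-\frac{\ell}{t}{\bf y}_{\ell,k}(t)+\frac{1}{t(\ell-1)!}{\bf v}-{\bf y}_{\ell,k}'(t),$$ and for $\ell=0$ by ${\bf r}_{0,k}(t)=-A{\bf y}_{0,k}(t)-{\bf y}_{0,k}'(t)$. *)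

theory Defs
  imports "HOL-Complex_Analysis.Complex_Analysis"
begin

definition phi :: "nat \<Rightarrow> complex \<Rightarrow> complex" where
  "phi l z =
    (if l = 0 then exp z
     else 1 / fact (l - 1) *
       integral {0..1} (\<lambda>\<theta>::real. exp (of_real (1 - \<theta>) * z) * of_real \<theta> ^ (l - 1)))"

definition mscale :: "complex \<Rightarrow> complex^'n^'m \<Rightarrow> complex^'n^'m" where
  "mscale c M = (\<chi> i j. c * M $ i $ j)"

(* On the type complex^'n^'n the operator ^ is the entrywise power, so matrix
   powers are written as iterated matrix products. *)
definition mpow :: "complex^'n^'n \<Rightarrow> nat \<Rightarrow> complex^'n^'n" where
  "mpow M j = (((**) M) ^^ j) (mat 1)"

(* Matrix function of an entire scalar function f: the Taylor series of f at 0
   evaluated at M.  It is only applied to the functions phi l, which are entire. *)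
definition matrix_fun :: "(complex \<Rightarrow> complex) \<Rightarrow> complex^'n^'n \<Rightarrow> complex^'n^'n" where
  "matrix_fun f M = (\<Sum>j. mscale ((deriv ^^ j) f 0 / fact j) (mpow M j))"

definition spec :: "complex^'n^'n \<Rightarrow> complex set" where
  "spec M = {z. \<exists>x. x \<noteq> 0 \<and> M *v x = z *s x}"

(* The inner product of the library on complex^'n is real-valued, hence this
   complex one, conjugate-linear in the first argument: cinner u w = u^H w. *)
definition cinner :: "complex^'n \<Rightarrow> complex^'n \<Rightarrow> complex" where
  "cinner u w = (\<Sum>i\<in>UNIV. cnj (u $ i) * w $ i)"

(* The rank-one matrix u w^H. *)
definition outer :: "complex^'m \<Rightarrow> complex^'n \<Rightarrow> complex^'n^'m" where
  "outer u w = (\<chi> i j. u $ i * cnj (w $ j))"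

(* Spectral norm: the norm of complex^'n is the Euclidean one, so this is the
   operator norm induced by the vector 2-norm. *)
definition norm2 :: "complex^'n^'m \<Rightarrow> real" where
  "norm2 M = onorm (\<lambda>x. M *v x)"

(* The k columns of V and the k rows and columns of H are indexed by a finite
   linear order 'k, with k = CARD('k); e_first and e_last are the vectors e_1
   and e_k. *)
definition e_first :: "complex^('k::{finite,linorder})" where
  "e_first = axis (Min UNIV) 1"

definition e_last :: "complex^('k::{finite,linorder})" where
  "e_last = axis (Max UNIV) 1"

definition upper_hessenberg :: "complex^('k::{finite,linorder})^('k::{finite,linorder}) \<Rightarrow> bool" where
  "upper_hessenberg H \<longleftrightarrow> (\<forall>i j. (\<exists>m. j < m \<and> m < i) \<longrightarrow> H $ i $ j = 0)"

(* (V, vnext, H, h) stands for (V_k, v_{k+1}, H_k, h_{k+1,k}). *)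
definition arnoldi ::
  "complex^'n^'n \<Rightarrow> complex^'n \<Rightarrow> complex^('k::{finite,linorder})^'n \<Rightarrow> complex^'n
    \<Rightarrow> complex^('k::{finite,linorder})^('k::{finite,linorder}) \<Rightarrow> real \<Rightarrow> bool" where
  "arnoldi A v V vnext H h \<longleftrightarrow>
     column (Min UNIV) V = (1 / complex_of_real (norm v)) *s v \<and>
     (\<forall>i j. cinner (column i V) (column j V) = (if i = j then 1 else 0)) \<and>
     (\<forall>i. cinner (column i V) vnext = 0) \<and>
     cinner vnext vnext = 1 \<and>
     vec.span (insert vnext (columns V)) =
       vec.span {mpow A j *v column (Min UNIV) V | j. j \<le> CARD('k)} \<and>
     upper_hessenberg H \<and>
     A ** V = V ** H + mscale (of_real h) (outer vnext e_last)"

definition exact_sol :: "nat \<Rightarrow> complex^'n^'n \<Rightarrow> complex^'n \<Rightarrow> real \<Rightarrow> complex^'n" where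
  "exact_sol l A v t = matrix_fun (phi l) ((- t) *\<^sub>R A) *v v"

definition krylov_approx ::
  "nat \<Rightarrow> complex^('k::{finite,linorder})^'n \<Rightarrow> complex^('k::{finite,linorder})^('k::{finite,linorder}) \<Rightarrow> real \<Rightarrow> real \<Rightarrow> complex^'n" where
  "krylov_approx l V H \<beta> t =
     V *v (matrix_fun (phi l) ((- t) *\<^sub>R H) *v (of_real \<beta> *s e_first))"

definition residual ::
  "nat \<Rightarrow> complex^'n^'n \<Rightarrow> complex^'n \<Rightarrow> (real \<Rightarrow> complex^'n) \<Rightarrow> real \<Rightarrow> complex^'n" where
  "residual l A v w t =
    (if l = 0 then - (A *v w t) - vector_derivative w (at t)
     else - (A *v w t) - (real l / t) *\<^sub>R w t + (1 / (t * fact (l - 1))) *\<^sub>R v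
          - vector_derivative w (at t))"

definition f_H ::
  "nat \<Rightarrow> complex^('k::{finite,linorder})^('k::{finite,linorder}) \<Rightarrow> real \<Rightarrow> real \<Rightarrow> complex \<Rightarrow> complex" where
  "f_H l H \<beta> t z =
     of_real t * phi l z *
       (cinner e_last (matrix_inv (mat z + t *\<^sub>R H) *v (of_real \<beta> *s e_first)) /
        cinner e_last (matrix_fun (phi l) ((- t) *\<^sub>R H) *v (of_real \<beta> *s e_first)))"

(* A positively oriented closed contour around S.  Positively oriented simple
   closed contours with S in their interior are the standard instance. *)
definition encloses :: "(real \<Rightarrow> complex) \<Rightarrow> complex set \<Rightarrow> bool" where
  "encloses \<gamma> S \<longleftrightarrow>
     valid_path \<gamma> \<and> pathfinish \<gamma> = pathstart \<gamma> \<and>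
     (\<forall>z\<in>S. z \<notin> path_image \<gamma> \<and> winding_number \<gamma> z = 1)"

definition vec_contour_integral ::
  "(real \<Rightarrow> complex) \<Rightarrow> (complex \<Rightarrow> complex^'n) \<Rightarrow> complex^'n" where
  "vec_contour_integral \<gamma> F = (\<chi> i. contour_integral \<gamma> (\<lambda>z. F z $ i))"

definition mat_contour_integral ::
  "(real \<Rightarrow> complex) \<Rightarrow> (complex \<Rightarrow> complex^'n^'m) \<Rightarrow> complex^'n^'m" where
  "mat_contour_integral \<gamma> F = (\<chi> i j. contour_integral \<gamma> (\<lambda>z. F z $ i $ j))"

end

(* Let M = -tA, N = -tH, x = beta e_1.  The Arnoldi relation intertwines the
   resolvents of M and N up to a rank-one term:
     V (z - N)^-1 x = (z - M)^-1 v + t h (e_k^H (z - N)^-1 x) (z - M)^-1 v_(k+1).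
   Multiplying by phi_l(z) and integrating, Cauchy's formula turns the difference of
   the outer terms into the error.  On the other side, u(t) = phi_l(-tH) x solves
   t u' + l u + t H u = x / (l-1)! (without the right-hand side if l = 0), so the
   residual collapses to -h (e_k^H u(t)) v_(k+1); this cancels the denominator of
   f_H and leaves the same integrand.

   Cauchy's formula for matrix functions: by the residue theorem the integral depends
   only on the winding numbers around the spectrum, so the contour may be replaced by
   a large circle around 0, on which the Neumann series of the resolvent converges
   uniformly and integrates term by term to the Taylor series of the function. *)

theory Submission
  imports Defs
begin

no_notation fps_nth (infixl \<open>$\<close> 75)

section \<open>Recurrence, power series and holomorphy of the functions phi_l\<close>

section \<open>The scalar functions\<close>

text \<open>Integration by parts in the defining integral. This is the induction step that leads
  from the integral to the power series.\<close>

lemma phi_Suc: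
  assumes "z \<noteq> 0"
  shows "phi (Suc l) z = (phi l z - 1 / fact l) / z"
proof (cases l)
  case 0
  have D: "((\<lambda>\<theta>. - exp ((1 - \<theta>) * z) / z) has_field_derivative exp ((1 - \<theta>) * z)) (at \<theta>)" for \<theta>
    using assms by (auto intro!: derivative_eq_intros)
  have "((\<lambda>\<theta>::real. exp (of_real (1 - \<theta>) * z)) has_integral
      (- exp (of_real (1 - 1) * z) / z) - (- exp (of_real (1 - 0) * z) / z)) {0..1}"
    by (rule fundamental_theorem_of_calculus) (use has_vector_derivative_real_field[OF D] in auto)
  then show ?thesis
    using assms 0 by (simp add: phi_def integral_unique diff_divide_distrib)
next
  case (Suc m)
  \<comment> \<open>The exponent as the derivative rule for \<open>\<theta> ^ l\<close> produces it,
    so that both sides of \<open>D\<close> match.\<close>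
  then have m: "m = l - Suc 0"
    by simp
  let ?E = "\<lambda>\<theta>::real. exp (of_real (1 - \<theta>) * z)"
  have int: "(\<lambda>\<theta>. ?E \<theta> * of_real \<theta> ^ k) integrable_on {0..1}" for k
    by (intro integrable_continuous_real continuous_intros)
  \<comment> \<open>The function differentiated here is 0 at \<theta> = 0, since
    \<open>l > 0\<close>, and 1 at \<theta> = 1; integrating its derivative links the integrals
    behind \<open>phi l\<close> and \<open>phi (Suc l)\<close>.\<close>
  have D: "((\<lambda>\<theta>. exp ((1 - \<theta>) * z) * \<theta> ^ l) has_field_derivative
      of_nat l * (exp ((1 - \<theta>) * z) * \<theta> ^ m) - z * (exp ((1 - \<theta>) * z) * \<theta> ^ l)) (at \<theta>)" for \<theta>
    unfolding m by (rule derivative_eq_intros refl)+ (simp add: algebra_simps)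
  have "((\<lambda>\<theta>::real. of_nat l * (?E \<theta> * of_real \<theta> ^ m) - z * (?E \<theta> * of_real \<theta> ^ l)) has_integral
      (?E 1 * of_real 1 ^ l) - (?E 0 * of_real 0 ^ l)) {0..1}"
    by (rule fundamental_theorem_of_calculus) (use has_vector_derivative_real_field[OF D] in auto)
  moreover have "((\<lambda>\<theta>::real. of_nat l * (?E \<theta> * of_real \<theta> ^ m) - z * (?E \<theta> * of_real \<theta> ^ l)) has_integral
      of_nat l * integral {0..1} (\<lambda>\<theta>. ?E \<theta> * of_real \<theta> ^ m)
        - z * integral {0..1} (\<lambda>\<theta>. ?E \<theta> * of_real \<theta> ^ l)) {0..1}"
    by (intro has_integral_diff has_integral_mult_right integrable_integral int)
  ultimately have "of_nat l * integral {0..1} (\<lambda>\<theta>. ?E \<theta> * of_real \<theta> ^ m)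
        - z * integral {0..1} (\<lambda>\<theta>. ?E \<theta> * of_real \<theta> ^ l) =
      (?E 1 * of_real 1 ^ l) - (?E 0 * of_real 0 ^ l)"
    by (rule has_integral_unique[rotated])
  then have "integral {0..1} (\<lambda>\<theta>. ?E \<theta> * of_real \<theta> ^ l) =
      (of_nat l * integral {0..1} (\<lambda>\<theta>. ?E \<theta> * of_real \<theta> ^ m) - 1) / z"
    using assms Suc by (simp add: field_simps)
  then have "phi (Suc l) z =
      1 / fact l * ((of_nat l * integral {0..1} (\<lambda>\<theta>. ?E \<theta> * of_real \<theta> ^ m) - 1) / z)"
    by (simp add: phi_def)
  also have "\<dots> = (phi l z - 1 / fact l) / z"
    using assms by (simp add: phi_def Suc diff_divide_distrib right_diff_distrib del: of_nat_Suc)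
  finally show ?thesis .
qed

text \<open>The recurrence divides by \<open>z\<close>, so the value at 0 is computed directly from
  the definition.\<close>

lemma phi_0: "phi l 0 = 1 / fact l"
proof (cases l)
  case (Suc m)
  then have m: "m = l - Suc 0" "l \<noteq> 0"
    by simp_all
  have D: "((\<lambda>\<theta>. \<theta> ^ l / of_nat l) has_field_derivative \<theta> ^ m) (at \<theta>)" for \<theta> :: complex
    unfolding m(1) using m(2) by (auto intro!: derivative_eq_intros)
  have "((\<lambda>\<theta>::real. complex_of_real \<theta> ^ m) has_integral
      of_real 1 ^ l / of_nat l - of_real 0 ^ l / of_nat l) {0..1}"
    by (rule fundamental_theorem_of_calculus) (use has_vector_derivative_real_field[OF D] in auto)
  then show ?thesis
    by (simp add: phi_def Suc integral_unique)
qed (simp add: phi_def)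

text \<open>For \<open>z \<noteq> 0\<close> the recurrence removes the constant term
  \<open>1 / fact l\<close> and divides by \<open>z\<close>, which shifts the series by one
  place.\<close>

lemma phi_sums: "(\<lambda>j. z ^ j / fact (j + l)) sums phi l z"
proof (cases "z = 0")
  case True
  have "(\<lambda>j. 0 ^ j / fact (j + l) :: complex) sums (0 ^ 0 / fact (0 + l))"
    using powser_sums_zero[of "\<lambda>j. 1 / fact (j + l) :: complex"] by simp
  then show ?thesis
    using True by (simp add: phi_0)
next
  case False
  show ?thesis
  proof (induction l)
    case 0
    show ?case
      using exp_converges[of z] by (simp add: phi_def scaleR_conv_of_real field_simps)
  next
    case (Suc l)
    have "(\<lambda>j. z ^ Suc j / fact (Suc j + l)) sums (phi l z - 1 / fact l)"
      using Suc by (subst sums_Suc_iff) simp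
    then have "(\<lambda>j. z ^ Suc j / fact (Suc j + l) / z) sums ((phi l z - 1 / fact l) / z)"
      by (rule sums_divide)
    then show ?case
      using False by (simp add: phi_Suc)
  qed
qed

lemma phi_has_fps_expansion: "phi l has_fps_expansion Abs_fps (\<lambda>j. 1 / fact (j + l))"
  by (rule has_fps_expansionI) (use phi_sums in simp)

lemma phi_taylor_coeff: "(deriv ^^ j) (phi l) 0 / fact j = 1 / fact (j + l)"
  using fps_nth_fps_expansion[OF phi_has_fps_expansion, of l j] by simp

lemma phi_holomorphic: "phi l holomorphic_on UNIV"
proof -
  have "phi l = (\<lambda>z. \<Sum>j. (1 / fact (j + l)) * z ^ j)"
    using phi_sums by (auto simp: sums_iff)
  moreover have "summable (\<lambda>j. (1 / fact (j + l)) * z ^ j)" for z :: complex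
    using phi_sums by (auto simp: sums_iff)
  ultimately have "\<exists>D. (phi l has_field_derivative D) (at z)" for z
    using termdiffs_strong_converges_everywhere[of "\<lambda>j. 1 / fact (j + l)"] by auto
  then show ?thesis
    by (simp add: holomorphic_on_open)
qed

section \<open>Entries, powers and norms of matrices; spectrum and holomorphy of the
  resolvent\<close>

section \<open>Matrices and resolvents\<close>

lemma matrix_inv_left_right:
  fixes M :: "'a::semiring_1^'n^'m"
  assumes "invertible M"
  shows "matrix_inv M ** M = mat 1" "M ** matrix_inv M = mat 1"
  using someI_ex[OF assms[unfolded invertible_def]] unfolding matrix_inv_def by auto

lemma mscale_nth [simp]: "mscale c M $ i $ j = c * M $ i $ j"
  by (simp add: mscale_def)

lemma mscale_mult_vec: "mscale c M *v x = c *s (M *v x)"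
  by (simp add: vec_eq_iff matrix_vector_mult_def sum_distrib_left mult.assoc)

lemma mat_mult_vec: "mat z *v x = z *s (x :: complex^'n)"
  by (simp add: vec_eq_iff matrix_vector_mult_def mat_def if_distrib if_distribR cong: if_cong)

lemma mpow_0 [simp]: "mpow M 0 *v x = x"
  by (simp add: mpow_def)

lemma mpow_Suc [simp]: "mpow M (Suc j) *v x = M *v (mpow M j *v x)"
  by (simp add: mpow_def matrix_vector_mul_assoc)

lemma mpow_mscale: "mpow (mscale c M) j *v x = c ^ j *s (mpow M j *v x)"
  by (induction j) (simp_all add: mscale_mult_vec vec.scale)

lemma scaleR_conv_mscale: "c *\<^sub>R (M :: complex^'n^'m) = mscale (of_real c) M"
  by (simp only: vec_eq_iff vector_scaleR_component mscale_nth) (simp add: scaleR_conv_of_real)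

lemma norm_scale_vec: "norm (c *s x) = norm c * norm (x :: complex^'n)"
  by (simp add: norm_vec_def norm_mult L2_set_right_distrib)

lemma norm_matrix_vec_le: "norm (M *v x) \<le> norm2 M * norm x"
  unfolding norm2_def by (rule onorm) simp

lemma norm2_nonneg: "norm2 M \<ge> 0"
  unfolding norm2_def by (rule onorm_pos_le) simp

lemma norm_mpow_vec_le: "norm (mpow M j *v x) \<le> norm2 M ^ j * norm x"
proof (induction j)
  case (Suc j)
  have "norm (M *v (mpow M j *v x)) \<le> norm2 M * norm (mpow M j *v x)"
    by (rule norm_matrix_vec_le)
  also have "\<dots> \<le> norm2 M * (norm2 M ^ j * norm x)"
    by (intro mult_left_mono Suc norm2_nonneg)
  finally show ?case by (simp add: mult.assoc)
qed simp

text \<open>The determinant form supplies the invertibility of \<open>mat z - M\<close>, the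
  denominator in Cramer's rule and an entire function whose zeros are the spectrum.\<close>

lemma not_spec_iff_det: "z \<notin> spec M \<longleftrightarrow> det (mat z - M) \<noteq> 0"
proof -
  have "z \<notin> spec M \<longleftrightarrow> (\<forall>x. (mat z - M) *v x = 0 \<longrightarrow> x = 0)"
    unfolding spec_def by (auto simp: matrix_vector_mult_diff_rdistrib mat_mult_vec)
  then show ?thesis
    by (metis invertible_det_nz invertible_left_inverse matrix_left_invertible_ker)
qed

lemma resolvent:
  assumes "z \<notin> spec M"
  shows "matrix_inv (mat z - M) ** (mat z - M) = mat 1" "(mat z - M) ** matrix_inv (mat z - M) = mat 1"
  using assms matrix_inv_left_right[of "mat z - M"] by (auto simp: not_spec_iff_det invertible_det_nz)

text \<open>Without a matrix difference, the resolvent equation is easily multiplied by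
  \<open>V\<close> or by powers of \<open>M\<close>, or estimated in norm.\<close>

lemma resolvent_vec_eq:
  assumes "z \<notin> spec M"
  shows "z *s (matrix_inv (mat z - M) *v x) = x + M *v (matrix_inv (mat z - M) *v x)"
proof -
  have "(mat z - M) *v (matrix_inv (mat z - M) *v x) = x"
    by (simp add: matrix_vector_mul_assoc resolvent assms)
  then show ?thesis
    by (simp add: matrix_vector_mult_diff_rdistrib mat_mult_vec algebra_simps)
qed

lemma resolvent_vec_unique:
  assumes "z \<notin> spec M" and "z *s w = x + M *v w"
  shows "matrix_inv (mat z - M) *v x = w"
proof -
  have "(mat z - M) *v w = x"
    using assms(2) by (simp add: matrix_vector_mult_diff_rdistrib mat_mult_vec)
  then show ?thesis
    using resolvent(1)[OF assms(1)] by (metis matrix_vector_mul_assoc matrix_vector_mul_lid)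
qed

lemma holomorphic_on_det:
  fixes M :: "complex \<Rightarrow> complex^'n^'n"
  assumes "\<And>i j. (\<lambda>z. M z $ i $ j) holomorphic_on S"
  shows "(\<lambda>z. det (M z)) holomorphic_on S"
  unfolding det_def by (intro holomorphic_intros assms)

lemma holomorphic_on_mat_diff: "(\<lambda>z. (mat z - M) $ i $ j) holomorphic_on S"
  by (cases "i = j") (auto simp: mat_def intro!: holomorphic_intros)

text \<open>Cramer's rule writes each component as a quotient of determinants with entries
  holomorphic in \<open>z\<close>; the denominator vanishes only on the spectrum.\<close>

lemma resolvent_holomorphic:
  fixes M :: "complex^'n^'n"
  shows "(\<lambda>z. (matrix_inv (mat z - M) *v x) $ i) holomorphic_on - spec M"
proof -
  \<comment> \<open>This is \<open>mat z - M\<close> with column \<open>i\<close> replaced by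
    \<open>x\<close>.\<close>
  let ?N = "\<lambda>z. (\<chi> a b. if b = i then x $ a else (mat z - M) $ a $ b) :: complex^'n^'n"
  have "(\<lambda>z. det (?N z) / det (mat z - M)) holomorphic_on - spec M"
  proof (intro holomorphic_on_divide holomorphic_on_det)
    show "(\<lambda>z. ?N z $ a $ b) holomorphic_on - spec M" for a b
      using holomorphic_on_mat_diff[of M a b] by (cases "b = i") simp_all
  qed (auto simp: not_spec_iff_det simp del: vector_minus_component intro: holomorphic_on_mat_diff)
  moreover have "(matrix_inv (mat z - M) *v x) $ i = det (?N z) / det (mat z - M)" if "z \<notin> spec M" for z
  proof -
    have "(mat z - M) *v (matrix_inv (mat z - M) *v x) = x"
      by (simp add: matrix_vector_mul_assoc resolvent that)
    then show ?thesis
      using that cramer[of "mat z - M" "matrix_inv (mat z - M) *v x" x] by (simp add: not_spec_iff_det)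
  qed
  ultimately show ?thesis
    by (subst holomorphic_cong[OF refl]) auto
qed

lemma norm_spec_le:
  assumes "z \<in> spec M"
  shows "norm z \<le> norm2 M"
proof -
  obtain x where "x \<noteq> 0" "M *v x = z *s x"
    using assms by (auto simp: spec_def)
  then show ?thesis
    using norm_matrix_vec_le[of M x] by (simp add: norm_scale_vec)
qed

text \<open>The residue theorem asks for finitely many singularities. The zeros of the
  characteristic determinant lie in a compact disc, so there are finitely many unless the
  determinant is constant.\<close>

lemma finite_spec: "finite (spec M)"
proof -
  let ?f = "\<lambda>z. det (mat z - M)" and ?R = "norm2 M + 1"
  show ?thesis
  proof (cases "?f constant_on UNIV")
    case True
    \<comment> \<open>A constant determinant is nonzero, because it is nonzero at this point beyond
      the bound on eigenvalues.\<close>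
    moreover have "of_real ?R \<notin> spec M"
      using norm_spec_le[of "of_real ?R" M] norm2_nonneg[of M] by (simp only: norm_of_real) auto
    ultimately have "spec M = {}"
      unfolding constant_on_def by (metis UNIV_I all_not_in_conv not_spec_iff_det)
    then show ?thesis by simp
  next
    case False
    have "finite {z \<in> cball 0 (norm2 M). ?f z = 0}"
      by (rule holomorphic_compact_finite_zeros[where S = UNIV])
         (use False in \<open>auto intro!: holomorphic_on_det holomorphic_on_mat_diff\<close>)
    moreover have "spec M = {z \<in> cball 0 (norm2 M). ?f z = 0}"
      using norm_spec_le[of _ M] not_spec_iff_det[of _ M] by (auto simp: mem_cball_0)
    ultimately show ?thesis by simp
  qed
qed

section \<open>Contour independence, Neumann series and the Cauchy formula\<close>

section \<open>The Cauchy integral formula for matrix functions\<close>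

text \<open>By the residue theorem in the whole plane both integrals are
  \<open>2 * pi * \<i>\<close> times the same sum of residues, all winding numbers being 1.\<close>

lemma contour_integral_cong_encloses:
  assumes "f holomorphic_on - P" "finite P" "encloses \<gamma> P" "encloses \<delta> P"
  shows "contour_integral \<gamma> f = contour_integral \<delta> f"
proof -
  have "contour_integral \<eta> f = 2 * pi * \<i> * (\<Sum>p\<in>P. residue f p)" if "encloses \<eta> P" for \<eta>
    using Residue_theorem[of UNIV P f \<eta>] assms(1,2) that
    by (auto simp: encloses_def Compl_eq_Diff_UNIV)
  then show ?thesis
    using assms by simp
qed

lemma contour_integrable_on_encloses:
  assumes "f holomorphic_on - P" "finite P" "encloses \<gamma> P"
  shows "f contour_integrable_on \<gamma>"
  using assms
  by (intro contour_integrable_holomorphic_simple[of f "- P"])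
     (auto simp: encloses_def finite_imp_closed open_Compl)

lemma encloses_mono: "encloses \<gamma> T \<Longrightarrow> S \<subseteq> T \<Longrightarrow> encloses \<gamma> S"
  by (auto simp: encloses_def)

lemma encloses_circlepath_spec:
  assumes "R > norm2 M"
  shows "encloses (circlepath 0 R) (spec M)"
proof -
  have "norm z < R" if "z \<in> spec M" for z
    using norm_spec_le[OF that] assms by simp
  moreover have "R > 0"
    using norm2_nonneg[of M] assms by simp
  ultimately show ?thesis
    by (fastforce simp: encloses_def winding_number_circlepath)
qed

text \<open>Take norms in \<open>z w = x + M w\<close> and solve for the norm of
  \<open>w\<close>.\<close>

lemma norm_resolvent_vec_le:
  assumes "norm z > norm2 M"
  shows "norm (matrix_inv (mat z - M) *v x) \<le> norm x / (norm z - norm2 M)"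
proof -
  let ?w = "matrix_inv (mat z - M) *v x"
  have "z \<notin> spec M"
    using assms norm_spec_le[of z M] by auto
  then have "norm z * norm ?w = norm (x + M *v ?w)"
    by (simp flip: norm_scale_vec add: resolvent_vec_eq)
  also have "\<dots> \<le> norm x + norm2 M * norm ?w"
    by (meson add_left_mono norm_matrix_vec_le norm_triangle_le)
  finally show ?thesis
    using assms by (simp add: field_simps)
qed

text \<open>Iterate \<open>w = (x + M w) / z\<close>. The remainder is kept exactly, in terms of the
  resolvent itself, so that the resolvent bound controls it.\<close>

lemma resolvent_neumann:
  assumes "z \<notin> spec M" "z \<noteq> 0"
  shows "matrix_inv (mat z - M) *v x =
    (\<Sum>j<J. (1 / z ^ Suc j) *s (mpow M j *v x)) + (1 / z ^ J) *s (mpow M J *v (matrix_inv (mat z - M) *v x))"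
proof (induction J)
  case (Suc J)
  let ?w = "matrix_inv (mat z - M) *v x"
  \<comment> \<open>\<open>mpow_Suc\<close> adds a factor on the left, whereas the resolvent
    equation yields one on the right.\<close>
  have comm: "mpow M J *v (M *v y) = M *v (mpow M J *v y)" for y
    by (induction J) simp_all
  have "z *s (mpow M J *v ?w) = mpow M J *v x + mpow M (Suc J) *v ?w"
    using arg_cong[OF resolvent_vec_eq[OF assms(1), of x], of "\<lambda>y. mpow M J *v y"]
    by (simp add: vec.scale vec.add comm)
  then have "(1 / z ^ Suc J) *s (z *s (mpow M J *v ?w)) = (1 / z ^ Suc J) *s (mpow M J *v x + mpow M (Suc J) *v ?w)"
    by simp
  then have "(1 / z ^ J) *s (mpow M J *v ?w) =
      (1 / z ^ Suc J) *s (mpow M J *v x) + (1 / z ^ Suc J) *s (mpow M (Suc J) *v ?w)"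
    using assms(2) by (simp add: vec.scale_right_distrib)
  with Suc show ?case
    by (simp add: add.assoc)
qed simp

text \<open>Multiplied by \<open>f\<close>, each Neumann term integrates to a Taylor term by
  Cauchy's formula for derivatives; uniform convergence on the circle permits the limit under the
  integral. The form \<open>sums\<close> gives convergence of the Taylor series along with its
  value.\<close>

lemma taylor_sums_circlepath:
  fixes M :: "complex^'n^'n"
  assumes f: "f holomorphic_on UNIV" and R: "R > norm2 M"
  shows "(\<lambda>j. (deriv ^^ j) f 0 / fact j * (mpow M j *v x) $ i) sums
    (1 / (2 * of_real pi * \<i>) *
      contour_integral (circlepath 0 R) (\<lambda>z. f z * (matrix_inv (mat z - M) *v x) $ i))"
proof -
  let ?w = "\<lambda>z. matrix_inv (mat z - M) *v x" and ?C = "circlepath 0 R"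
  define g where "g J z = (\<Sum>j<J. f z / z ^ Suc j * (mpow M j *v x) $ i)" for J z
  define q where "q = norm2 M / R"
  have R0: "R > 0" and q: "0 \<le> q" "q < 1"
    using R norm2_nonneg[of M] by (auto simp: q_def field_simps)
  have "compact (f ` sphere 0 R)"
    using f by (intro compact_continuous_image) (auto intro: holomorphic_on_imp_continuous_on holomorphic_on_subset)
  then obtain B where B: "\<And>z. z \<in> sphere 0 R \<Longrightarrow> norm (f z) \<le> B"
    using compact_imp_bounded[of "f ` sphere 0 R"] unfolding bounded_iff by blast
  \<comment> \<open>The bound for \<open>f\<close> on the circle times the resolvent bound there;
    the powers of \<open>M\<close> and of \<open>1 / z\<close> in the remainder contribute
    \<open>q ^ J\<close>.\<close>
  define K where "K = B * (norm x / (R - norm2 M))"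
  have bound: "dist (g J z) (f z * ?w z $ i) \<le> K * q ^ J" if z: "z \<in> sphere 0 R" for J z
  proof -
    have nz: "norm z = R" "z \<noteq> 0" and spec: "z \<notin> spec M"
      using z R R0 norm_spec_le[of z M] by auto
    have "f z * ?w z $ i - g J z = f z * ((1 / z ^ J) * (mpow M J *v ?w z) $ i)"
      by (subst resolvent_neumann[OF spec nz(2), of x J])
         (simp add: g_def sum_distrib_left algebra_simps)
    then have "dist (g J z) (f z * ?w z $ i) = norm (f z) * (norm ((mpow M J *v ?w z) $ i) / R ^ J)"
      using nz by (subst dist_commute) (simp add: dist_norm norm_mult norm_divide norm_power)
    also have "\<dots> \<le> B * ((norm2 M ^ J * (norm x / (R - norm2 M))) / R ^ J)"
    proof (intro mult_mono divide_right_mono)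
      have "norm ((mpow M J *v ?w z) $ i) \<le> norm2 M ^ J * norm (?w z)"
        using Finite_Cartesian_Product.norm_nth_le norm_mpow_vec_le order_trans by blast
      also have "\<dots> \<le> norm2 M ^ J * (norm x / (R - norm2 M))"
        using norm_resolvent_vec_le[of M z x] nz R norm2_nonneg[of M] by (intro mult_left_mono) auto
      finally show "norm ((mpow M J *v ?w z) $ i) \<le> norm2 M ^ J * (norm x / (R - norm2 M))" .
    qed (use B[OF z] R0 order_trans[OF norm_ge_zero B[OF z]] in auto)
    finally show ?thesis
      by (simp add: K_def q_def power_divide mult_ac)
  qed
  have unif: "uniform_limit (sphere 0 R) g (\<lambda>z. f z * ?w z $ i) sequentially"
  proof (rule uniform_limitI)
    fix e :: real assume "e > 0"
    have "(\<lambda>J. K * q ^ J) \<longlonglongrightarrow> 0"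
      using q by (intro tendsto_mult_right_zero LIMSEQ_power_zero) simp
    then have "\<forall>\<^sub>F J in sequentially. K * q ^ J < e"
      using \<open>e > 0\<close> by (rule order_tendstoD)
    then show "\<forall>\<^sub>F J in sequentially. \<forall>z\<in>sphere 0 R. dist (g J z) (f z * ?w z $ i) < e"
      by eventually_elim (use bound le_less_trans in blast)
  qed
  have int: "(g J has_contour_integral
      (\<Sum>j<J. 2 * of_real pi * \<i> * ((deriv ^^ j) f 0 / fact j * (mpow M j *v x) $ i))) ?C" for J
    unfolding g_def
  proof (rule has_contour_integral_sum)
    fix j
    have "((\<lambda>u. f u / (u - 0) ^ Suc j) has_contour_integral (2 * pi * \<i>) / fact j * (deriv ^^ j) f 0) ?C"
      using f R0
      by (intro Cauchy_has_contour_integral_higher_derivative_circlepath)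
         (auto intro: holomorphic_on_imp_continuous_on holomorphic_on_subset)
    from has_contour_integral_rmul[OF this, of "(mpow M j *v x) $ i"]
    show "((\<lambda>z. f z / z ^ Suc j * (mpow M j *v x) $ i) has_contour_integral
        2 * of_real pi * \<i> * ((deriv ^^ j) f 0 / fact j * (mpow M j *v x) $ i)) ?C"
      by (simp add: mult_ac)
  qed simp
  have "(\<lambda>J. contour_integral ?C (g J)) \<longlonglongrightarrow> contour_integral ?C (\<lambda>z. f z * ?w z $ i)"
    using has_contour_integral_integrable[OF int]
    by (intro contour_integral_uniform_limit_circlepath(2)[OF _ unif _ R0]) simp_all
  then have "(\<lambda>J. 1 / (2 * of_real pi * \<i>) * (\<Sum>j<J. 2 * of_real pi * \<i> * ((deriv ^^ j) f 0 / fact j * (mpow M j *v x) $ i)))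
      \<longlonglongrightarrow> 1 / (2 * of_real pi * \<i>) * contour_integral ?C (\<lambda>z. f z * ?w z $ i)"
    by (intro tendsto_mult tendsto_const) (simp only: contour_integral_unique[OF int])
  then show ?thesis
    unfolding sums_def sum_distrib_left[symmetric] by simp
qed

text \<open>Transfers results on matrix-vector products to single matrix entries.\<close>

lemma matrix_nth_conv_mult_axis: "M $ a $ b = (M *v axis b 1) $ a" for M :: "complex^'n^'m"
  by (simp add: matrix_vector_mult_def axis_def if_distrib cong: if_cong)

text \<open>An infinite sum is meaningful only if it converges, so this comes before any evaluation
  of \<open>matrix_fun\<close>. Convergence is entrywise, from the circle computation applied to
  unit vectors.\<close>

lemma matrix_fun_summable:
  fixes M :: "complex^'n^'n"
  assumes "f holomorphic_on UNIV"
  shows "summable (\<lambda>j. mscale ((deriv ^^ j) f 0 / fact j) (mpow M j))"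
proof -
  define L where "L = (\<chi> a b. \<Sum>j. (deriv ^^ j) f 0 / fact j * mpow M j $ a $ b)"
  have "(\<lambda>j. (deriv ^^ j) f 0 / fact j * mpow M j $ a $ b) sums L $ a $ b" for a b
    unfolding L_def
    using taylor_sums_circlepath[OF assms, of M "norm2 M + 1" "axis b 1" a]
    by (simp add: sums_iff flip: matrix_nth_conv_mult_axis)
  then have "(\<lambda>j. mscale ((deriv ^^ j) f 0 / fact j) (mpow M j)) sums L"
    unfolding sums_def by (intro vec_tendstoI) (simp add: mscale_def)
  then show ?thesis
    by (rule sums_summable)
qed

lemma matrix_fun_vec_sums:
  fixes M :: "complex^'n^'n"
  assumes "f holomorphic_on UNIV"
  shows "(\<lambda>j. ((deriv ^^ j) f 0 / fact j) *s (mpow M j *v x)) sums (matrix_fun f M *v x)"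
proof -
  have "bounded_linear (\<lambda>N::complex^'n^'n. N *v x)"
    by (rule bounded_linearI')
       (simp_all add: vec_eq_iff matrix_vector_mult_def scaleR_sum_right sum.distrib distrib_right)
  from bounded_linear.sums[OF this summable_sums[OF matrix_fun_summable[OF assms, of M]]]
  show ?thesis
    by (simp add: matrix_fun_def mscale_mult_vec)
qed

text \<open>The contour is exchanged for a circle of radius \<open>norm2 M + 1\<close>, where the
  integral is the Taylor series. The form \<open>has_contour_integral\<close> also records
  integrability, so that such integrals can be combined linearly.\<close>

lemma matrix_fun_vec_contour_integral:
  fixes M :: "complex^'n^'n"
  assumes "f holomorphic_on UNIV" "encloses \<gamma> (spec M)"
  shows "((\<lambda>z. f z * (matrix_inv (mat z - M) *v x) $ i) has_contour_integral
    2 * of_real pi * \<i> * (matrix_fun f M *v x) $ i) \<gamma>"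
proof -
  let ?F = "\<lambda>z. f z * (matrix_inv (mat z - M) *v x) $ i"
  have R: "norm2 M + 1 > norm2 M"
    by simp
  have holo: "?F holomorphic_on - spec M"
    using assms(1) by (intro holomorphic_on_mult resolvent_holomorphic) (auto intro: holomorphic_on_subset)
  then have "contour_integral \<gamma> ?F = contour_integral (circlepath 0 (norm2 M + 1)) ?F"
    using assms(2) encloses_circlepath_spec[OF R] finite_spec by (intro contour_integral_cong_encloses)
  moreover have "(\<lambda>j. (((deriv ^^ j) f 0 / fact j) *s (mpow M j *v x)) $ i) sums (matrix_fun f M *v x) $ i"
    by (intro sums_vec_nth matrix_fun_vec_sums assms)
  ultimately have "contour_integral \<gamma> ?F = 2 * of_real pi * \<i> * (matrix_fun f M *v x) $ i"
    using taylor_sums_circlepath[OF assms(1) R, of x i] by (auto simp: sums_iff field_simps)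
  moreover have "?F contour_integrable_on \<gamma>"
    using assms(2) by (intro contour_integrable_on_encloses[OF holo finite_spec])
  ultimately show ?thesis
    using has_contour_integral_integral[of ?F \<gamma>] by (simp only:)
qed

section \<open>Differential equation, residual, resolvent identity and error\<close>

section \<open>Residual and error of the Arnoldi approximation\<close>

lemma has_vector_derivative_vecI:
  fixes g :: "real \<Rightarrow> complex^'n"
  assumes "\<And>i. ((\<lambda>t. g t $ i) has_vector_derivative g' $ i) (at t)"
  shows "(g has_vector_derivative g') (at t)"
  unfolding has_vector_derivative_def has_derivative_within
proof (intro conjI vec_tendstoI)
  show "((\<lambda>y. ((1 / norm (y - t)) *\<^sub>R (g y - (g t + (y - t) *\<^sub>R g'))) $ i) \<longlongrightarrow> 0 $ i) (at t)" for i
    using assms[of i] unfolding has_vector_derivative_def has_derivative_within by simp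
qed (rule bounded_linear_scaleR_left)

text \<open>With \<open>s\<close> pulled out of the matrix powers, each component is an ordinary
  power series in \<open>s\<close>.\<close>

lemma phi_matrix_fun_vec_sums:
  "(\<lambda>j. (s ^ j / fact (j + l)) *s (mpow H j *v x)) sums (matrix_fun (phi l) (mscale s H) *v x)"
  using matrix_fun_vec_sums[OF phi_holomorphic, of l "mscale s H" x]
  by (simp add: phi_taylor_coeff mpow_mscale)

text \<open>Compare coefficients: \<open>s D + l F\<close> multiplies the \<open>j\<close>-th one by
  \<open>j + l\<close>, which for \<open>j > 0\<close> turns \<open>1 / fact (j + l)\<close> into
  \<open>1 / fact (j + l - 1)\<close>, as in \<open>s H F\<close>. The term \<open>j = 0\<close> is
  left over.\<close>

lemma phi_matrix_fun_ode:
  fixes H :: "complex^'n^'n" and x :: "complex^'n" and l :: nat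
  defines "F \<equiv> \<lambda>s. matrix_fun (phi l) (mscale s H) *v x"
  obtains D where "\<And>i. ((\<lambda>s. F s $ i) has_field_derivative D $ i) (at s)"
    and "s *s D + of_nat l *s F s = (if l = 0 then 0 else 1 / fact (l - 1)) *s x + s *s (H *v F s)"
proof -
  define a where "a i j = (mpow H j *v x) $ i / fact (j + l)" for i j
  define D where "D = (\<chi> i. \<Sum>n. diffs (a i) n * s ^ n)"
  have F: "(\<lambda>j. a i j * z ^ j) sums F z $ i" for i z
    using sums_vec_nth[OF phi_matrix_fun_vec_sums[of z l H x], of i]
    by (simp add: F_def a_def mult_ac)
  then have summable: "summable (\<lambda>j. a i j * z ^ j)" for i z
    by (rule sums_summable)
  have "((\<lambda>z. \<Sum>j. a i j * z ^ j) has_field_derivative D $ i) (at s)" for i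
    unfolding D_def using termdiffs_strong_converges_everywhere[OF summable] by simp
  then have deriv: "((\<lambda>z. F z $ i) has_field_derivative D $ i) (at s)" for i
    using F by (simp add: sums_iff)
  have "s * D $ i + of_nat l * F s $ i =
      (if l = 0 then 0 else 1 / fact (l - 1)) * x $ i + s * (H *v F s) $ i" for i
  proof -
    have "(\<lambda>n. diffs (a i) n * s ^ n) sums D $ i"
      unfolding D_def using termdiff_converges_all[OF summable] by (simp add: summable_sums)
    from sums_mult[OF this, of s]
    have "(\<lambda>n. of_nat (Suc n) * a i (Suc n) * s ^ Suc n) sums (s * D $ i)"
      by (simp add: diffs_def mult_ac)
    then have "(\<lambda>j. of_nat j * a i j * s ^ j) sums (s * D $ i)"
      by (subst (asm) sums_Suc_iff) simp
    from sums_add[OF this sums_mult[OF F, of "of_nat l" i s]]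
    have lhs: "(\<lambda>j. of_nat (j + l) * a i j * s ^ j) sums (s * D $ i + of_nat l * F s $ i)"
      by (simp add: algebra_simps)
    have "(\<lambda>j. H *v ((s ^ j / fact (j + l)) *s (mpow H j *v x))) sums (H *v F s)"
      unfolding F_def by (intro bounded_linear.sums[OF matrix_vector_mul_bounded_linear] phi_matrix_fun_vec_sums)
    from sums_mult[OF sums_vec_nth[OF this, of i], of s]
    have "(\<lambda>j. s * (s ^ j / fact (j + l) * (mpow H (Suc j) *v x) $ i)) sums (s * (H *v F s) $ i)"
      by (simp add: vec.scale)
    moreover have "s * (s ^ j / fact (j + l) * y) = of_nat (Suc j + l) * (y / fact (Suc j + l)) * s ^ Suc j" for j y
      by (simp add: field_simps del: of_nat_Suc of_nat_add)
    ultimately have "(\<lambda>j. of_nat (Suc j + l) * a i (Suc j) * s ^ Suc j) sums (s * (H *v F s) $ i)"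
      unfolding a_def by simp
    \<comment> \<open>The added term \<open>j = 0\<close> is the inhomogeneity; its factor
      \<open>l / fact l\<close> is 0 for \<open>l = 0\<close>.\<close>
    then have "(\<lambda>j. of_nat (j + l) * a i j * s ^ j) sums (s * (H *v F s) $ i + of_nat l * a i 0)"
      by (subst (asm) sums_Suc_iff) simp
    moreover have "of_nat l * a i 0 = (if l = 0 then 0 else 1 / fact (l - 1)) * x $ i"
      by (cases l) (simp_all add: a_def del: of_nat_Suc)
    ultimately show ?thesis
      using sums_unique2[OF lhs] by (simp add: add.commute)
  qed
  with deriv show ?thesis
    by (intro that[of D]) (simp_all only: vec_eq_iff vector_add_component vector_smult_component simp_thms)
qed

lemma cinner_e_last: "cinner e_last x = x $ Max UNIV"
  by (simp add: cinner_def e_last_def axis_def if_distrib if_distribR cong: if_cong)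

lemma outer_mult_vec: "outer u w *v x = cinner w x *s u"
  by (simp add: vec_eq_iff outer_def cinner_def matrix_vector_mult_def sum_distrib_left mult_ac)

lemma arnoldi_mult_vec:
  assumes "arnoldi A v V vnext H h"
  shows "A *v (V *v x) = V *v (H *v x) + (of_real h * cinner e_last x) *s vnext"
proof -
  have "(A ** V) *v x = (V ** H + mscale (of_real h) (outer vnext e_last)) *v x"
    using assms by (simp add: arnoldi_def)
  then show ?thesis
    by (simp add: matrix_vector_mul_assoc matrix_vector_mult_add_rdistrib mscale_mult_vec outer_mult_vec)
qed

lemma arnoldi_start:
  assumes "arnoldi A v V vnext H h" "v \<noteq> 0"
  shows "V *v (of_real (norm v) *s e_first) = v"
proof -
  have "V *v e_first = column (Min UNIV) V"
    by (simp add: e_first_def column_def vec_eq_iff flip: matrix_nth_conv_mult_axis)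
  then show ?thesis
    using assms by (simp add: vec.scale arnoldi_def)
qed

lemma scaleR_conv_scale_vec: "c *\<^sub>R x = of_real c *s (x :: complex^'n)"
  by (simp only: vec_eq_iff vector_scaleR_component vector_smult_component) (simp add: scaleR_conv_of_real)

text \<open>The differential equation at \<open>s = -t\<close> cancels everything in the residual
  except \<open>V H F - A V F\<close>, which the Arnoldi relation makes a multiple of
  \<open>vnext\<close>.\<close>

lemma residual_krylov_approx:
  fixes H :: "complex^('k::{finite,linorder})^('k::{finite,linorder})"
  assumes arn: "arnoldi A v V vnext H h" and "v \<noteq> 0" "t > 0"
  shows "residual l A v (krylov_approx l V H (norm v)) t =
    - (of_real h * cinner e_last (matrix_fun (phi l) ((- t) *\<^sub>R H) *v (of_real (norm v) *s e_first))) *s vnext"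
proof -
  define x where "x = complex_of_real (norm v) *s (e_first :: complex^('k::{finite,linorder}))"
  define F where "F s = matrix_fun (phi l) (mscale s H) *v x" for s
  define c :: complex where "c = (if l = 0 then 0 else 1 / fact (l - 1))"
  obtain D where D: "\<And>i. ((\<lambda>s. F s $ i) has_field_derivative D $ i) (at (of_real (- t)))"
    and ode: "of_real (- t) *s D + of_nat l *s F (of_real (- t)) = c *s x + of_real (- t) *s (H *v F (of_real (- t)))"
    unfolding F_def c_def using phi_matrix_fun_ode[of l H x "of_real (- t)"] by metis
  have Vx: "V *v x = v"
    unfolding x_def using arn \<open>v \<noteq> 0\<close> by (rule arnoldi_start)
  have "((\<lambda>\<tau>. F (of_real (- \<tau>))) has_vector_derivative - D) (at t)"
  proof (rule has_vector_derivative_vecI)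
    fix i
    have "((\<lambda>z. F (- z) $ i) has_field_derivative D $ i * - 1) (at (of_real t))"
      by (rule DERIV_chain2[where f = "\<lambda>z. F z $ i"]) (use D[of i] in \<open>auto intro!: derivative_eq_intros\<close>)
    from has_vector_derivative_real_field[OF this]
    show "((\<lambda>\<tau>. F (of_real (- \<tau>)) $ i) has_vector_derivative (- D) $ i) (at t)"
      by simp
  qed
  then have "((\<lambda>\<tau>. V *v F (of_real (- \<tau>))) has_vector_derivative V *v (- D)) (at t)"
    by (rule bounded_linear.has_vector_derivative[OF matrix_vector_mul_bounded_linear])
  moreover have krylov: "krylov_approx l V H (norm v) = (\<lambda>\<tau>. V *v F (of_real (- \<tau>)))"
    by (simp add: krylov_approx_def F_def x_def scaleR_conv_mscale fun_eq_iff)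
  ultimately have deriv: "vector_derivative (krylov_approx l V H (norm v)) (at t) = - (V *v D)"
    by (simp add: vector_derivative_at vec.neg)
  let ?F = "F (of_real (- t))"
  have "of_real t *s (V *v D) = of_nat l *s (V *v ?F) - c *s v + of_real t *s (V *v (H *v ?F))"
    using arg_cong[OF ode, of "\<lambda>y. V *v y"]
    by (simp add: vec.add vec.scale vec.neg Vx algebra_simps)
  then have "(1 / of_real t) *s (of_real t *s (V *v D)) =
      (1 / of_real t) *s (of_nat l *s (V *v ?F) - c *s v + of_real t *s (V *v (H *v ?F)))"
    by (rule arg_cong)
  then have VD: "V *v D = (of_nat l / of_real t) *s (V *v ?F) - (c / of_real t) *s v + V *v (H *v ?F)"
    using \<open>t > 0\<close> by (simp add: vec.scale_right_distrib vec.scale_right_diff_distrib)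
  have "residual l A v (krylov_approx l V H (norm v)) t =
      - (A *v (V *v ?F)) - (of_nat l / of_real t) *s (V *v ?F) + (c / of_real t) *s v + V *v D"
    \<comment> \<open>\<open>deriv\<close> comes first, because \<open>krylov\<close> would rewrite
      the term that it has to match.\<close>
    unfolding residual_def deriv unfolding krylov by (simp add: c_def scaleR_conv_scale_vec)
  also have "\<dots> = - (of_real h * cinner e_last ?F) *s vnext"
    unfolding VD arnoldi_mult_vec[OF arn] by simp
  finally show ?thesis
    by (simp add: F_def x_def scaleR_conv_mscale)
qed

text \<open>Applying \<open>V\<close> to the resolvent equation of \<open>-tH\<close> and trading
  \<open>V H\<close> for \<open>A V\<close> shows that \<open>V *v a z\<close> solves the resolvent
  equation of \<open>-tA\<close>, with \<open>v\<close> perturbed by a multiple of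
  \<open>vnext\<close>. Uniqueness does the rest.\<close>

lemma arnoldi_resolvent:
  fixes H :: "complex^('k::{finite,linorder})^('k::{finite,linorder})" and v :: "complex^'n" and t :: real
  defines "a \<equiv> \<lambda>z. matrix_inv (mat z - (- t) *\<^sub>R H) *v (of_real (norm v) *s e_first)"
  assumes arn: "arnoldi A v V vnext H h" and "v \<noteq> 0"
    and zA: "z \<notin> spec ((- t) *\<^sub>R A)" and zH: "z \<notin> spec ((- t) *\<^sub>R H)"
  shows "V *v a z = matrix_inv (mat z - (- t) *\<^sub>R A) *v v +
    (of_real (t * h) * cinner e_last (a z)) *s (matrix_inv (mat z - (- t) *\<^sub>R A) *v vnext)"
proof -
  let ?k = "of_real (t * h) * cinner e_last (a z)"
  have "z *s a z = of_real (norm v) *s e_first + ((- t) *\<^sub>R H) *v a z"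
    unfolding a_def by (rule resolvent_vec_eq[OF zH])
  from arg_cong[OF this, of "\<lambda>y. V *v y"]
  have "z *s (V *v a z) = v - of_real t *s (V *v (H *v a z))"
    using arnoldi_start[OF arn \<open>v \<noteq> 0\<close>]
    by (simp add: vec.scale vec.add vec.diff vec.neg scaleR_conv_mscale mscale_mult_vec)
  also have "\<dots> = (v + ?k *s vnext) + ((- t) *\<^sub>R A) *v (V *v a z)"
    by (simp add: scaleR_conv_mscale mscale_mult_vec arnoldi_mult_vec[OF arn] vec.scale_right_distrib algebra_simps)
  finally have "matrix_inv (mat z - (- t) *\<^sub>R A) *v (v + ?k *s vnext) = V *v a z"
    by (rule resolvent_vec_unique[OF zA])
  then show ?thesis
    by (simp add: vec.add vec.scale)
qed

text \<open>\<open>contour_integral\<close> is a total function; integrability of all entries is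
  what makes it linear here.\<close>

lemma mat_contour_integral_mult_vec:
  assumes "\<And>i j. (\<lambda>z. F z $ i $ j) contour_integrable_on \<gamma>"
  shows "mat_contour_integral \<gamma> F *v x = vec_contour_integral \<gamma> (\<lambda>z. F z *v x)"
  by (simp add: vec_eq_iff mat_contour_integral_def vec_contour_integral_def matrix_vector_mult_def
      contour_integral_sum contour_integral_rmul contour_integrable_rmul assms)

theorem theorem4p1:
  fixes A :: "complex^'n^'n" and v vnext :: "complex^'n"
    and V :: "complex^('k::{finite,linorder})^'n" and H :: "complex^('k::{finite,linorder})^('k::{finite,linorder})"
    and h t \<beta> :: real and l :: nat and \<gamma> :: "real \<Rightarrow> complex"
    and err res :: "complex^'n"
  assumes "t > 0"
    and "\<forall>z \<in> spec ((- t) *\<^sub>R A). Re z \<le> 0"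
    and "v \<noteq> 0"
    and "\<beta> = norm v"
    and "arnoldi A v V vnext H h"
    and "encloses \<gamma> (spec ((- t) *\<^sub>R A) \<union> spec ((- t) *\<^sub>R H))"
    and "phi l analytic_on (path_image \<gamma> \<union> inside (path_image \<gamma>))"
    and "cinner e_last (matrix_fun (phi l) ((- t) *\<^sub>R H) *v (of_real \<beta> *s e_first)) \<noteq> 0"
    and "err = exact_sol l A v t - krylov_approx l V H \<beta> t"
    and "res = residual l A v (krylov_approx l V H \<beta>) t"
  shows "err = (1 / (2 * of_real pi * \<i>)) *s
           vec_contour_integral \<gamma>
             (\<lambda>z. f_H l H \<beta> t z *s (matrix_inv (mat z + t *\<^sub>R A) *v res))
       \<and> norm err \<le>
           norm2 (mscale (1 / (2 * of_real pi * \<i>))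
             (mat_contour_integral \<gamma>
               (\<lambda>z. mscale (f_H l H \<beta> t z) (matrix_inv (mat z + t *\<^sub>R A))))) * norm res"
proof -
  define M N where "M = (- t) *\<^sub>R A" and "N = (- t) *\<^sub>R H"
  define x where "x = complex_of_real \<beta> *s (e_first :: complex^('k::{finite,linorder}))"
  define R where "R z = matrix_inv (mat z - M)" for z
  define a where "a z = matrix_inv (mat z - N) *v x" for z
  define \<kappa> where "\<kappa> = cinner e_last (matrix_fun (phi l) N *v x)"
  have \<kappa>: "\<kappa> \<noteq> 0"
    using assms(8) by (simp add: \<kappa>_def N_def x_def)
  have enc: "encloses \<gamma> (spec M \<union> spec N)"
    using assms(6) by (simp add: M_def N_def)
  then have encM: "encloses \<gamma> (spec M)" and encN: "encloses \<gamma> (spec N)"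
    by (auto intro: encloses_mono)
  have res: "res = - (of_real h * \<kappa>) *s vnext"
    using residual_krylov_approx[OF assms(5,3,1), of l] assms(4,10) by (simp add: \<kappa>_def N_def x_def)
  have f_H: "f_H l H \<beta> t z = of_real t * phi l z * (cinner e_last (a z) / \<kappa>)" for z
    by (simp add: f_H_def a_def N_def x_def \<kappa>_def)
  have R: "matrix_inv (mat z + t *\<^sub>R A) = R z" for z
    by (simp add: R_def M_def)
  \<comment> \<open>On the contour both resolvents exist, as the path avoids both spectra. The
    factor \<kappa> in \<open>res\<close> cancels the denominator of \<open>f_H\<close>.\<close>
  have pointwise: "(phi l z *s (R z *v v - V *v a z)) $ i = (f_H l H \<beta> t z *s (R z *v res)) $ i"
    if "z \<in> path_image \<gamma>" for z i
  proof -
    have z: "z \<notin> spec M" "z \<notin> spec N"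
      using enc that by (auto simp: encloses_def)
    have "R z *v v - V *v a z = - ((of_real (t * h) * cinner e_last (a z)) *s (R z *v vnext))"
      using arnoldi_resolvent[OF assms(5,3) z[unfolded M_def N_def]]
      by (simp add: R_def a_def M_def N_def x_def assms(4))
    then show ?thesis
      using \<kappa> by (simp add: f_H res vec.scale vec.neg)
  qed
  \<comment> \<open>Cauchy's formula for \<open>M\<close> and for \<open>N\<close>; the constant
    matrix \<open>V\<close> passes through the integral as a finite sum.\<close>
  have int: "((\<lambda>z. (phi l z *s (R z *v v - V *v a z)) $ i) has_contour_integral
      2 * of_real pi * \<i> * err $ i) \<gamma>" for i
  proof -
    have "((\<lambda>z. \<Sum>j\<in>UNIV. V $ i $ j * (phi l z * a z $ j)) has_contour_integral
        (\<Sum>j\<in>UNIV. V $ i $ j * (2 * of_real pi * \<i> * (matrix_fun (phi l) N *v x) $ j))) \<gamma>"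
      unfolding a_def
      by (intro has_contour_integral_sum has_contour_integral_lmul matrix_fun_vec_contour_integral
          phi_holomorphic encN) simp
    from has_contour_integral_diff[OF matrix_fun_vec_contour_integral[OF phi_holomorphic encM, of l v i] this]
    show ?thesis
      unfolding assms(9) exact_sol_def krylov_approx_def
      by (simp add: R_def M_def N_def x_def matrix_vector_mult_def[of V] sum_distrib_left
          right_diff_distrib mult_ac)
  qed
  have "vec_contour_integral \<gamma> (\<lambda>z. f_H l H \<beta> t z *s (R z *v res)) = (2 * of_real pi * \<i>) *s err"
    using contour_integral_eq[OF pointwise] contour_integral_unique[OF int]
    by (simp add: vec_contour_integral_def vec_eq_iff)
  then have err: "err = (1 / (2 * of_real pi * \<i>)) *s
      vec_contour_integral \<gamma> (\<lambda>z. f_H l H \<beta> t z *s (R z *v res))"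
    by simp
  \<comment> \<open>Integrability allows \<open>res\<close> to be pulled out of the matrix integral.
    \<open>f_H\<close> may be singular on \<open>spec N\<close> and \<open>R\<close> on
    \<open>spec M\<close>, hence the union.\<close>
  have "(\<lambda>z. mscale (f_H l H \<beta> t z) (R z) $ i $ j) contour_integrable_on \<gamma>" for i j
  proof (rule contour_integrable_on_encloses[OF _ _ enc])
    have "(\<lambda>z. (R z *v axis j 1) $ i) holomorphic_on - (spec M \<union> spec N)"
      "(\<lambda>z. a z $ Max UNIV) holomorphic_on - (spec M \<union> spec N)"
      unfolding R_def a_def by (auto intro: holomorphic_on_subset[OF resolvent_holomorphic])
    moreover have "phi l holomorphic_on - (spec M \<union> spec N)"
      using phi_holomorphic holomorphic_on_subset by blast
    ultimately show "(\<lambda>z. mscale (f_H l H \<beta> t z) (R z) $ i $ j) holomorphic_on - (spec M \<union> spec N)"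
      unfolding mscale_nth f_H cinner_e_last matrix_nth_conv_mult_axis[of "R z" for z]
      by (intro holomorphic_intros) (use \<kappa> in auto)
  qed (simp add: finite_spec)
  from mat_contour_integral_mult_vec[OF this, of res]
  have "err = mscale (1 / (2 * of_real pi * \<i>))
      (mat_contour_integral \<gamma> (\<lambda>z. mscale (f_H l H \<beta> t z) (R z))) *v res"
    unfolding err by (simp add: mscale_mult_vec)
  then show ?thesis
    unfolding R using err norm_matrix_vec_le by metis
qed

end
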